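(* Let $m,n\geq 1$, let $M_1,\dots,M_m$ and $N_1,\dots,N_n$ be path-connected locally uniquely geodesic metric spaces, none of which is a single point, and let $f:\prod_{i=1}^m M_i\rightarrow \prod_{i=1}^n N_i$ be an isometry, where both products carry the sup metric. Then $m=n$ and $f$ is reducible; that is, there exist a permutation $\pi$ of $\{1,\dots,m\}$ and isometries $f_i:M_i\rightarrow N_{\pi(i)}$ for $i=1,\dots,m$ such that for all $(\alpha_1,\dots,\alpha_m)\in\prod_{i=1}^m M_i$, $$f(\alpha_1,\dots,\alpha_m)=\bigl(f_{\pi^{-1}(1)}(\alpha_{\pi^{-1}(1)}),\dots,f_{\pi^{-1}(m)}(\alpha_{\pi^{-1}(m)})\bigr).$$
   Context: The sup metric on a finite product $\prod_{i=1}^m M_i$ of metric spaces is $d\bigl((\alpha_i),(\beta_i)\bigr)=\max_{i} d_{M_i}(\alpha_i,\beta_i)$. An isometry is a distance-preserving bijection between metric spaces. A geodesic from $p$ to $q$ in a metric space is a distance-preserving map $[0,d(p,q)]\to X$ (or its image) starting at $p$ and ending at $q$. A metric space is uniquely geodesic if any two of its points are joined by exactly one geodesic. A metric space is locally uniquely geodesic if every point is the center of some metric ball of positive radius which, with the restricted metric, is a uniquely geodesic metric space. *)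

theory Defs
  imports "HOL-Analysis.Analysis" "HOL-Combinatorics.Permutations"
begin

definition metric_isometry :: "'a metric \<Rightarrow> 'b metric \<Rightarrow> ('a \<Rightarrow> 'b) \<Rightarrow> bool" where
  "metric_isometry X Y f \<longleftrightarrow>
     bij_betw f (mspace X) (mspace Y) \<and>
     (\<forall>x\<in>mspace X. \<forall>y\<in>mspace X. mdist Y (f x) (f y) = mdist X x y)"

definition geodesic_between :: "'a metric \<Rightarrow> 'a \<Rightarrow> 'a \<Rightarrow> (real \<Rightarrow> 'a) \<Rightarrow> bool" where
  "geodesic_between X p q g \<longleftrightarrow>
     g \<in> {0..mdist X p q} \<rightarrow> mspace X \<and>
     (\<forall>s\<in>{0..mdist X p q}. \<forall>t\<in>{0..mdist X p q}. mdist X (g s) (g t) = \<bar>s - t\<bar>) \<and>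
     g 0 = p \<and> g (mdist X p q) = q"

text \<open>Extensionality makes the count of geodesics independent of the values outside the
  interval on which a geodesic lives.\<close>

definition uniquely_geodesic :: "'a metric \<Rightarrow> bool" where
  "uniquely_geodesic X \<longleftrightarrow>
     (\<forall>p\<in>mspace X. \<forall>q\<in>mspace X.
        \<exists>!g. g \<in> extensional {0..mdist X p q} \<and> geodesic_between X p q g)"

definition locally_uniquely_geodesic :: "'a metric \<Rightarrow> bool" where
  "locally_uniquely_geodesic X \<longleftrightarrow>
     (\<forall>x\<in>mspace X. \<exists>r>0. uniquely_geodesic (submetric X (mball_of X x r)))"

definition sup_dist :: "nat \<Rightarrow> (nat \<Rightarrow> 'a metric) \<Rightarrow> (nat \<Rightarrow> 'a) \<Rightarrow> (nat \<Rightarrow> 'a) \<Rightarrow> real" where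
  "sup_dist m M x y = Max ((\<lambda>i. mdist (M i) (x i) (y i)) ` {1..m})"

text \<open>Points of the product of \<open>M 1, \<dots>, M m\<close> are functions that are \<open>undefined\<close> outside
  \<open>{1..m}\<close>. Only \<open>m \<ge> 1\<close> is meaningful.\<close>

definition sup_product :: "nat \<Rightarrow> (nat \<Rightarrow> 'a metric) \<Rightarrow> (nat \<Rightarrow> 'a) metric" where
  "sup_product m M = metric (\<Pi>\<^sub>E i\<in>{1..m}. mspace (M i), sup_dist m M)"

lemma Metric_space_sup_product:
  assumes "m \<ge> 1"
  shows "Metric_space (\<Pi>\<^sub>E i\<in>{1..m}. mspace (M i)) (sup_dist m M)"
proof -
  have ne: "{1..m} \<noteq> {}" using assms by auto
  have ge: "mdist (M i) (x i) (y i) \<le> sup_dist m M x y" if "i \<in> {1..m}" for i x y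
    unfolding sup_dist_def using that by (intro Max_ge) auto
  have le: "sup_dist m M x y \<le> b"
    if "\<And>i. i \<in> {1..m} \<Longrightarrow> mdist (M i) (x i) (y i) \<le> b" for x y b
    unfolding sup_dist_def using that ne by (subst Max_le_iff) auto
  have nonneg: "0 \<le> sup_dist m M x y" for x y
    using ge[of 1 x y] mdist_nonneg[of "M 1" "x 1" "y 1"] assms by (simp del: mdist_nonneg)
  show ?thesis
  proof
    fix x y show "0 \<le> sup_dist m M x y" by (rule nonneg)
  next
    fix x y show "sup_dist m M x y = sup_dist m M y x"
      unfolding sup_dist_def by (simp add: mdist_commute)
  next
    fix x y
    assume x: "x \<in> (\<Pi>\<^sub>E i\<in>{1..m}. mspace (M i))" and y: "y \<in> (\<Pi>\<^sub>E i\<in>{1..m}. mspace (M i))"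
    show "sup_dist m M x y = 0 \<longleftrightarrow> x = y"
    proof
      assume 0: "sup_dist m M x y = 0"
      show "x = y"
      proof (rule PiE_ext[OF x y])
        fix i assume i: "i \<in> {1..m}"
        then have "mdist (M i) (x i) (y i) = 0"
          using ge[OF i, of x y] 0 mdist_nonneg[of "M i" "x i" "y i"] by linarith
        then show "x i = y i"
          using mdist_zero[of "x i" "M i" "y i"] PiE_mem[OF x i] PiE_mem[OF y i] by simp
      qed
    next
      assume xy: "x = y"
      have "sup_dist m M x y \<le> 0"
      proof (rule le)
        fix i assume i: "i \<in> {1..m}"
        then show "mdist (M i) (x i) (y i) \<le> 0"
          using mdist_zero[OF PiE_mem[OF y i] PiE_mem[OF y i]] xy by (metis order_refl)
      qed
      then show "sup_dist m M x y = 0" using nonneg[of x y] by linarith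
    qed
  next
    fix x y z
    assume x: "x \<in> (\<Pi>\<^sub>E i\<in>{1..m}. mspace (M i))" and y: "y \<in> (\<Pi>\<^sub>E i\<in>{1..m}. mspace (M i))"
      and z: "z \<in> (\<Pi>\<^sub>E i\<in>{1..m}. mspace (M i))"
    show "sup_dist m M x z \<le> sup_dist m M x y + sup_dist m M y z"
    proof (rule le)
      fix i assume i: "i \<in> {1..m}"
      have "mdist (M i) (x i) (z i) \<le> mdist (M i) (x i) (y i) + mdist (M i) (y i) (z i)"
        by (rule mdist_triangle[OF PiE_mem[OF x i] PiE_mem[OF y i] PiE_mem[OF z i]])
      then show "mdist (M i) (x i) (z i) \<le> sup_dist m M x y + sup_dist m M y z"
        using ge[OF i, of x y] ge[OF i, of y z] by linarith
    qed
  qed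
qed

lemma mspace_sup_product [simp]:
  "m \<ge> 1 \<Longrightarrow> mspace (sup_product m M) = (\<Pi>\<^sub>E i\<in>{1..m}. mspace (M i))"
  unfolding sup_product_def by (rule Metric_space.mspace_metric[OF Metric_space_sup_product])

lemma mdist_sup_product [simp]:
  "m \<ge> 1 \<Longrightarrow> mdist (sup_product m M) = sup_dist m M"
  unfolding sup_product_def by (rule Metric_space.mdist_metric[OF Metric_space_sup_product])

end

theory Submission
  imports Defs
begin

text \<open>In the sup metric the points within distance \<open>e\<close> of both \<open>p\<close> and \<open>q\<close> form a box: the product over
  the coordinates \<open>i\<close> of the \<^emph>\<open>lenses\<close> formed from \<open>p i\<close> and \<open>q i\<close>. Take \<open>d(p,q) = 2 * e\<close> small. A
  coordinate in which \<open>p\<close> and \<open>q\<close> realise this distance has a one-point lens, because midpoints are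
  unique at small scale; every other coordinate has slack, and its lens has several points. An
  isometry carries boxes to boxes, and this alone reveals the coordinates.

  Call a point of a factor \<^emph>\<open>central\<close> if it is the midpoint of segments of every small length.
  Interior points of geodesics are central, so central points are dense. A point \<open>z\<close> of the product
  with all coordinates central is a one-point box at every small scale; its image is then also one,
  so \<open>f z\<close> has all coordinates central (\<open>central_point_image\<close>).

  Spread \<open>p\<close> and \<open>q\<close> apart from such a \<open>z\<close> in the single coordinate \<open>i\<close>. Their box contains all points
  near \<open>z\<close> with the same \<open>i\<close>-th coordinate, and some coordinate \<open>j\<close> realises the distance of \<open>f p\<close> and
  \<open>f q\<close>, so near \<open>z\<close> the \<open>i\<close>-th coordinate of the argument determines the \<open>j\<close>-th coordinate of the
  value (\<open>controls_exists\<close>). The same holds for the inverse of \<open>f\<close>. If going forth and back led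
  from coordinate \<open>i\<close> to another coordinate \<open>k\<close>, the \<open>i\<close>-th coordinate would determine the \<open>k\<close>-th one,
  which is absurd because no factor has isolated points (\<open>controls_comp\<close>). So at \<open>z\<close> the relation
  between \<open>i\<close> and \<open>j\<close> is a bijection, and \<open>m = n\<close>.

  Finally this bijection does not depend on \<open>z\<close>. When one coordinate \<open>k\<close> of \<open>z\<close> varies, the partner
  \<open>j\<close> of every \<open>i \<noteq> k\<close> and the \<open>j\<close>-th coordinate of the value are locally constant. A locally constant
  predicate on the central points of a connected factor is constant, since nearby central points
  are joined by geodesics of central points (\<open>central_locally_constant\<close>). The partner of \<open>k\<close> is then
  the one that remains. Changing the coordinates one at a time reaches every central point, and density
  gives the statement for all points (\<open>coordinate_determined\<close>): the \<open>j\<close>-th coordinate of \<open>f z\<close> is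
  a function of \<open>z i\<close>. That function is the isometry between the factors; it does not increase
  distances because \<open>f\<close> does not, and its inverse does not because the inverse of \<open>f\<close> does not.\<close>

section \<open>Midpoints and central points in a factor\<close>

definition lens :: "'a metric \<Rightarrow> 'a \<Rightarrow> 'a \<Rightarrow> real \<Rightarrow> 'a set" where
  "lens X a b e = {c \<in> mspace X. mdist X a c \<le> e \<and> mdist X c b \<le> e}"

text \<open>Geodesics between points of a small ball may leave the ball, so existence of geodesics and
  uniqueness of midpoints refer to the whole space. Unlike geodesic convexity of a ball, this
  property passes to smaller radii.\<close>

definition normal_radius :: "'a metric \<Rightarrow> 'a \<Rightarrow> real \<Rightarrow> bool" where
  "normal_radius X x r \<longleftrightarrow> 0 < r \<and>
     (\<forall>a\<in>mball_of X x r. \<forall>b\<in>mball_of X x r.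
        (\<exists>g. geodesic_between X a b g) \<and>
        (\<forall>c\<in>lens X a b (mdist X a b / 2). \<forall>c'\<in>lens X a b (mdist X a b / 2). c = c'))"

text \<open>Requiring segments of every small length, not only of one length, allows the same half-length \<open>e\<close> to be
  chosen in all coordinates of a product at once.\<close>

definition central :: "'a metric \<Rightarrow> 'a \<Rightarrow> bool" where
  "central X c \<longleftrightarrow> c \<in> mspace X \<and>
     (\<exists>\<delta>>0. \<forall>e. 0 < e \<and> e < \<delta> \<longrightarrow>
        (\<exists>a\<in>mspace X. \<exists>b\<in>mspace X. mdist X a c = e \<and> mdist X c b = e \<and> mdist X a b = 2 * e))"

text \<open>What the argument uses about a factor. A factor with more than one point is needed: a one-point factor
  could be added to a product without changing its metric.\<close>

definition factor_space :: "'a metric \<Rightarrow> bool" where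
  "factor_space X \<longleftrightarrow> connected_space (mtopology_of X) \<and> mspace X \<noteq> {} \<and>
     (\<nexists>x. mspace X = {x}) \<and> (\<forall>x\<in>mspace X. \<exists>r. normal_radius X x r)"

lemma mdist_self: "x \<in> mspace X \<Longrightarrow> mdist X x x = 0"
  using mdist_zero[of x X x] by simp

lemma geodesic_betweenD:
  assumes "geodesic_between X a b g" and "t \<in> {0..mdist X a b}"
  shows "g t \<in> mspace X" and "mdist X a (g t) = t" and "mdist X (g t) b = mdist X a b - t"
    and "s \<in> {0..mdist X a b} \<Longrightarrow> mdist X (g s) (g t) = \<bar>s - t\<bar>"
proof -
  have dist: "mdist X (g u) (g v) = \<bar>u - v\<bar>"
    if "u \<in> {0..mdist X a b}" "v \<in> {0..mdist X a b}" for u v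
    using assms that unfolding geodesic_between_def by blast
  have ends: "g 0 = a" "g (mdist X a b) = b"
    using assms unfolding geodesic_between_def by auto
  show "g t \<in> mspace X" using assms unfolding geodesic_between_def by blast
  show "s \<in> {0..mdist X a b} \<Longrightarrow> mdist X (g s) (g t) = \<bar>s - t\<bar>" using dist assms(2) by blast
  show "mdist X a (g t) = t" using dist[of 0 t] ends assms(2) by auto
  show "mdist X (g t) b = mdist X a b - t" using dist[of t "mdist X a b"] ends assms(2) by auto
qed

lemma geodesic_concat:
  assumes a: "a \<in> mspace X" and b: "b \<in> mspace X" and c: "c \<in> mspace X"
    and g: "geodesic_between X a c g" and h: "geodesic_between X c b h"
    and add: "mdist X a b = mdist X a c + mdist X c b"
  shows "geodesic_between X a b (\<lambda>t. if t \<le> mdist X a c then g t else h (t - mdist X a c))"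
    (is "geodesic_between X a b ?k")
proof -
  let ?u = "mdist X a c" and ?v = "mdist X c b" and ?D = "mdist X a b"
  have u0: "0 \<le> ?u" and v0: "0 \<le> ?v" by auto
  have mem: "?k t \<in> mspace X" if "t \<in> {0..?D}" for t
    using that geodesic_betweenD(1)[OF g, of t] geodesic_betweenD(1)[OF h, of "t - ?u"] add by auto
  have mono: "mdist X (?k s) (?k t) = t - s" if s: "s \<in> {0..?D}" and t: "t \<in> {0..?D}" and st: "s \<le> t" for s t
  proof -
    consider "t \<le> ?u" | "s > ?u" | "s \<le> ?u" "t > ?u" using st by linarith
    then show ?thesis
    proof cases
      case 1
      then show ?thesis using geodesic_betweenD(4)[OF g, of t s] s st by auto
    next
      case 2
      then show ?thesis using geodesic_betweenD(4)[OF h, of "t - ?u" "s - ?u"] s t st add by auto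
    next
      case 3
      have s': "s \<in> {0..?u}" and t': "t - ?u \<in> {0..?v}" using 3 s t add by auto
      have gm: "g s \<in> mspace X" and hm: "h (t - ?u) \<in> mspace X"
        using geodesic_betweenD(1)[OF g s'] geodesic_betweenD(1)[OF h t'] by auto
      have "mdist X (g s) (h (t - ?u)) \<le> mdist X (g s) c + mdist X c (h (t - ?u))"
        by (rule mdist_triangle[OF gm c hm])
      moreover have "mdist X a b \<le> mdist X a (g s) + mdist X (g s) b"
        by (rule mdist_triangle[OF a gm b])
      moreover have "mdist X (g s) b \<le> mdist X (g s) (h (t - ?u)) + mdist X (h (t - ?u)) b"
        by (rule mdist_triangle[OF gm hm b])
      ultimately show ?thesis
        using geodesic_betweenD(2,3)[OF g s'] geodesic_betweenD(2,3)[OF h t'] add 3 by auto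
    qed
  qed
  have "mdist X (?k s) (?k t) = \<bar>s - t\<bar>" if s: "s \<in> {0..?D}" and t: "t \<in> {0..?D}" for s t
    using mono[OF s t] mono[OF t s] mdist_commute[of X "?k s" "?k t"] by (cases "s \<le> t") auto
  moreover have "?k 0 = a" using g u0 unfolding geodesic_between_def by auto
  moreover have "?k ?D = b"
  proof (cases "?v = 0")
    case True
    then have "c = b" using mdist_zero[OF c b] by simp
    then show ?thesis using g unfolding geodesic_between_def by auto
  next
    case False
    then have "\<not> ?D \<le> ?u" and "?D - ?u = ?v" using v0 add by linarith+
    then show ?thesis using h unfolding geodesic_between_def by simp
  qed
  ultimately show ?thesis using mem unfolding geodesic_between_def by auto
qed

text \<open>Half of the radius of a uniquely geodesic ball is enough: a midpoint \<open>c\<close> of two points \<open>a\<close>, \<open>b\<close> of the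
  half-size ball still lies in the large ball, and joining geodesics from \<open>a\<close> to \<open>c\<close> and from \<open>c\<close> to \<open>b\<close>
  gives a geodesic from \<open>a\<close> to \<open>b\<close> through \<open>c\<close>. Geodesics being unique, \<open>c\<close> is the midpoint of
  the given one.\<close>

lemma locally_uniquely_geodesic_normal_radius:
  assumes "locally_uniquely_geodesic X" and x: "x \<in> mspace X"
  shows "\<exists>r. normal_radius X x r"
proof -
  obtain R where R: "R > 0" and ug: "uniquely_geodesic (submetric X (mball_of X x R))"
    using assms unfolding locally_uniquely_geodesic_def by blast
  let ?B = "submetric X (mball_of X x R)"
  have B: "mspace ?B = mball_of X x R" by auto
  have ex: "\<exists>g. geodesic_between ?B a b g" if "a \<in> mspace ?B" "b \<in> mspace ?B" for a b
    using ug that unfolding uniquely_geodesic_def by blast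
  have unique: "g t = h t" if ab: "a \<in> mspace ?B" "b \<in> mspace ?B"
    and g: "geodesic_between ?B a b g" and h: "geodesic_between ?B a b h"
    and t: "t \<in> {0..mdist X a b}" for a b g h t
  proof -
    have restr: "geodesic_between ?B a b (restrict k {0..mdist X a b})"
      if "geodesic_between ?B a b k" for k
      using that unfolding geodesic_between_def by auto
    have "restrict g {0..mdist X a b} = restrict h {0..mdist X a b}"
      using ug ab restr[OF g] restr[OF h] unfolding uniquely_geodesic_def
      by (metis mdist_submetric restrict_extensional)
    then show ?thesis using t by (metis restrict_apply')
  qed
  have "normal_radius X x (R / 2)"
    unfolding normal_radius_def
  proof (intro conjI ballI)
    show "0 < R / 2" using R by simp
  next
    fix a b assume a: "a \<in> mball_of X x (R / 2)" and b: "b \<in> mball_of X x (R / 2)"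
    have aX: "a \<in> mspace X" and bX: "b \<in> mspace X" using a b by auto
    have aB: "a \<in> mspace ?B" and bB: "b \<in> mspace ?B" using a b R by auto
    obtain g where g: "geodesic_between ?B a b g" using ex[OF aB bB] by blast
    then show "\<exists>g. geodesic_between X a b g" unfolding geodesic_between_def by auto
    have key: "c = g (mdist X a b / 2)" if c: "c \<in> lens X a b (mdist X a b / 2)" for c
    proof -
      have cX: "c \<in> mspace X" and le: "mdist X a c \<le> mdist X a b / 2" "mdist X c b \<le> mdist X a b / 2"
        using c unfolding lens_def by auto
      have tri: "mdist X a b \<le> mdist X a c + mdist X c b" by (rule mdist_triangle[OF aX cX bX])
      have ac: "mdist X a c = mdist X a b / 2" and cb: "mdist X c b = mdist X a b / 2"
        using le tri by auto
      have "mdist X a b \<le> mdist X a x + mdist X x b" by (rule mdist_triangle[OF aX x bX])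
      then have "mdist X a b < R" using a b by (auto simp: mdist_commute[of X a x])
      moreover have "mdist X x c \<le> mdist X x a + mdist X a c" by (rule mdist_triangle[OF x aX cX])
      ultimately have "mdist X x c < R" using a ac by auto
      then have cB: "c \<in> mspace ?B" using x cX by auto
      obtain g1 h1 where "geodesic_between ?B a c g1" "geodesic_between ?B c b h1"
        using ex aB bB cB by meson
      then have k: "geodesic_between ?B a b
          (\<lambda>t. if t \<le> mdist ?B a c then g1 t else h1 (t - mdist ?B a c))"
        using ac cb by (intro geodesic_concat[OF aB bB cB]) auto
      have "g1 (mdist X a b / 2) = c"
        using \<open>geodesic_between ?B a c g1\<close> ac unfolding geodesic_between_def by auto
      then show ?thesis using unique[OF aB bB g k, of "mdist X a b / 2"] ac by auto
    qed
    fix c c' assume "c \<in> lens X a b (mdist X a b / 2)" "c' \<in> lens X a b (mdist X a b / 2)"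
    then show "c = c'" using key by metis
  qed
  then show ?thesis by blast
qed

lemma openin_mtopology_of:
  "openin (mtopology_of X) U \<longleftrightarrow> U \<subseteq> mspace X \<and> (\<forall>x\<in>U. \<exists>r>0. mball_of X x r \<subseteq> U)"
  unfolding mtopology_of_def mball_of_def
  by (subst Metric_space.openin_mtopology[OF Metric_space_mspace_mdist]) blast

lemma factor_space_no_isolated:
  assumes X: "factor_space X" and x: "x \<in> mspace X" and e: "e > 0"
  shows "\<exists>y\<in>mspace X. y \<noteq> x \<and> mdist X x y < e"
proof (rule ccontr)
  assume "\<not> ?thesis"
  then have iso: "y = x" if "y \<in> mspace X" "mdist X x y < e" for y using that by blast
  have "openin (mtopology_of X) {x}"
    unfolding openin_mtopology_of using x e iso by (auto intro!: exI[of _ e])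
  moreover have "openin (mtopology_of X) (mspace X - {x})"
    unfolding openin_mtopology_of
  proof (intro conjI ballI)
    fix y assume y: "y \<in> mspace X - {x}"
    then have "mdist X x y \<ge> e" using iso[of y] by force
    then show "\<exists>r>0. mball_of X y r \<subseteq> mspace X - {x}"
      using e by (intro exI[of _ e]) (auto simp: mdist_commute)
  qed auto
  moreover have "{x} \<union> (mspace X - {x}) = topspace (mtopology_of X)" using x by auto
  moreover have "mspace X - {x} \<noteq> {}" using X x unfolding factor_space_def by blast
  moreover have "connected_space (mtopology_of X)" using X unfolding factor_space_def by blast
  ultimately show False unfolding connected_space_eq by blast
qed

lemma geodesic_central:
  assumes g: "geodesic_between X a b g" and t: "0 < t" "t < mdist X a b"
  shows "central X (g t)"
  unfolding central_def
proof (intro conjI exI allI impI)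
  show "g t \<in> mspace X" using geodesic_betweenD(1)[OF g] t by auto
  show "0 < min t (mdist X a b - t)" using t by auto
  fix e assume e: "0 < e \<and> e < min t (mdist X a b - t)"
  show "\<exists>a\<in>mspace X. \<exists>b\<in>mspace X.
      mdist X a (g t) = e \<and> mdist X (g t) b = e \<and> mdist X a b = 2 * e"
  proof (rule bexI[of _ "g (t - e)"], rule bexI[of _ "g (t + e)"], intro conjI)
    have t0: "t \<in> {0..mdist X a b}" and t1: "t - e \<in> {0..mdist X a b}"
      and t2: "t + e \<in> {0..mdist X a b}" using e t by auto
    show "g (t - e) \<in> mspace X" "g (t + e) \<in> mspace X"
      using geodesic_betweenD(1)[OF g] t1 t2 by blast+
    show "mdist X (g (t - e)) (g t) = e" using geodesic_betweenD(4)[OF g t0 t1] e by simp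
    show "mdist X (g t) (g (t + e)) = e" using geodesic_betweenD(4)[OF g t2 t0] e by simp
    show "mdist X (g (t - e)) (g (t + e)) = 2 * e"
      using geodesic_betweenD(4)[OF g t2 t1] e by simp
  qed
qed

lemma normal_radius_geodesic:
  assumes "normal_radius X x r" and "a \<in> mball_of X x r" and "b \<in> mball_of X x r"
  shows "\<exists>g. geodesic_between X a b g"
  using assms unfolding normal_radius_def by blast

lemma factor_space_normal_radius:
  assumes "factor_space X" and "x \<in> mspace X"
  obtains r where "r > 0" and "normal_radius X x r"
  using assms unfolding factor_space_def normal_radius_def by blast

lemma central_dense:
  assumes X: "factor_space X" and x: "x \<in> mspace X" and e: "e > 0"
  shows "\<exists>c. central X c \<and> mdist X x c < e"
proof -
  obtain r where r: "r > 0" "normal_radius X x r" using factor_space_normal_radius[OF X x] .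
  obtain y where y: "y \<in> mspace X" "y \<noteq> x" "mdist X x y < min r e"
    using factor_space_no_isolated[OF X x, of "min r e"] r e by auto
  let ?D = "mdist X x y"
  have D: "?D > 0" using y x mdist_zero[OF x y(1)] mdist_nonneg[of X x y] by (metis order_le_imp_less_or_eq)
  obtain g where g: "geodesic_between X x y g"
    using r y x mdist_self[OF x] unfolding normal_radius_def by fastforce
  have "central X (g (?D / 2))" using geodesic_central[OF g] D by auto
  moreover have "mdist X x (g (?D / 2)) = ?D / 2" using geodesic_betweenD(2)[OF g] D by auto
  ultimately show ?thesis using y D by (intro exI[of _ "g (?D / 2)"]) auto
qed

lemma lens_unique:
  assumes "normal_radius X x r" and "a \<in> mball_of X x r" and "b \<in> mball_of X x r"
    and "mdist X a b = 2 * e" and "c \<in> lens X a b e" and "c' \<in> lens X a b e"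
  shows "c = c'"
  using assms unfolding normal_radius_def by auto

text \<open>If \<open>a\<close> and \<open>b\<close> are closer than \<open>2 * e\<close>, all points near their midpoint belong to the lens, and the
  midpoint is not isolated.\<close>

lemma lens_nontrivial:
  assumes X: "factor_space X" and r: "normal_radius X x r"
    and a: "a \<in> mball_of X x r" and b: "b \<in> mball_of X x r" and e: "mdist X a b < 2 * e"
  shows "\<exists>c'\<in>lens X a b e. c' \<noteq> c"
proof -
  have aX: "a \<in> mspace X" and bX: "b \<in> mspace X" using a b by auto
  let ?D = "mdist X a b"
  obtain g where g: "geodesic_between X a b g" using r a b unfolding normal_radius_def by blast
  define m where "m = g (?D / 2)"
  have h: "?D / 2 \<in> {0..?D}" by auto
  have mX: "m \<in> mspace X" and am: "mdist X a m = ?D / 2" and mb: "mdist X m b = ?D / 2"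
    using geodesic_betweenD[OF g h] unfolding m_def by auto
  obtain y where y: "y \<in> mspace X" "y \<noteq> m" "mdist X m y < e - ?D / 2"
    using factor_space_no_isolated[OF X mX, of "e - ?D / 2"] e by auto
  have "mdist X a y \<le> mdist X a m + mdist X m y" by (rule mdist_triangle[OF aX mX y(1)])
  moreover have "mdist X y b \<le> mdist X y m + mdist X m b" by (rule mdist_triangle[OF y(1) mX bX])
  ultimately have "y \<in> lens X a b e" using y am mb mdist_commute[of X y m] unfolding lens_def by auto
  moreover have "m \<in> lens X a b e" using mX am mb e unfolding lens_def by auto
  ultimately show ?thesis using y by metis
qed

text \<open>The set of central points is connected, in the form of a principle about locally constant
  predicates. A predicate on the central points is constant along geodesics between them, hence
  constant near every point of \<open>X\<close>, central or not; by density the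
  local value is well defined, and connectedness of \<open>X\<close> makes it global.\<close>

lemma central_locally_constant:
  fixes P :: "'a \<Rightarrow> bool"
  assumes X: "factor_space X"
    and loc: "\<And>c. central X c \<Longrightarrow> \<exists>\<rho>>0. \<forall>c'. central X c' \<and> mdist X c c' < \<rho> \<longrightarrow> P c' = P c"
    and a: "central X a" and b: "central X b"
  shows "P a = P b"
proof -
  have centralX: "central X c \<Longrightarrow> c \<in> mspace X" for c unfolding central_def by blast
  have along: "P v" if u: "central X u" and v: "central X v" and g: "geodesic_between X u v g"
      and P: "P u" for u v g
  proof -
    let ?D = "mdist X u v"
    have ends: "g 0 = u" "g ?D = v" using g unfolding geodesic_between_def by auto
    have cg: "central X (g t)" if "t \<in> {0..?D}" for t
    proof (cases "t = 0 \<or> t = ?D")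
      case True
      then show ?thesis using ends u v by auto
    next
      case False
      then show ?thesis using geodesic_central[OF g] that by auto
    qed
    have "P (g ?D)"
    proof (rule connected_induction_simple[where S = "{0..?D}" and a = 0 and P = "\<lambda>t. P (g t)"])
      show "connected {0..?D}" by simp
      show "P (g 0)" using ends P by simp
      fix t assume t: "t \<in> {0..?D}"
      obtain \<rho> where \<rho>: "\<rho> > 0" "\<And>c'. central X c' \<Longrightarrow> mdist X (g t) c' < \<rho> \<Longrightarrow> P c' = P (g t)"
        using loc[OF cg[OF t]] by blast
      have "P (g s) = P (g t)" if s: "s \<in> {0..?D} \<inter> ball t \<rho>" for s
      proof -
        have s': "s \<in> {0..?D}" and st: "\<bar>t - s\<bar> < \<rho>" using s by (simp_all add: dist_real_def)
        show ?thesis using \<rho>(2)[OF cg[OF s']] geodesic_betweenD(4)[OF g s' t] st by simp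
      qed
      then have "\<forall>x\<in>{0..?D} \<inter> ball t \<rho>. \<forall>y\<in>{0..?D} \<inter> ball t \<rho>. P (g x) \<longrightarrow> P (g y)"
        by metis
      moreover have "openin (top_of_set {0..?D}) ({0..?D} \<inter> ball t \<rho>)"
        by (rule openin_open_Int) simp
      moreover have "t \<in> {0..?D} \<inter> ball t \<rho>" using t \<rho>(1) by (intro IntI) simp_all
      ultimately show "\<exists>T. openin (top_of_set {0..?D}) T \<and> t \<in> T \<and>
          (\<forall>x\<in>T. \<forall>y\<in>T. P (g x) \<longrightarrow> P (g y))"
        by blast
    qed auto
    then show ?thesis using ends by simp
  qed
  define V where
    "V Q = {x \<in> mspace X. \<exists>r>0. \<forall>c. central X c \<and> mdist X x c < r \<longrightarrow> Q c}" for Q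
  have openV: "openin (mtopology_of X) (V Q)" for Q
    unfolding openin_mtopology_of
  proof (intro conjI ballI)
    fix x assume "x \<in> V Q"
    then obtain r where x: "x \<in> mspace X" and r: "r > 0"
      and Q: "\<And>c. central X c \<Longrightarrow> mdist X x c < r \<Longrightarrow> Q c" unfolding V_def by blast
    have "y \<in> V Q" if y: "y \<in> mball_of X x (r / 2)" for y
    proof -
      have yX: "y \<in> mspace X" using y by auto
      have "Q c" if c: "central X c" and "mdist X y c < r / 2" for c
        using Q[OF c] mdist_triangle[OF x yX centralX[OF c]] y that by auto
      then show ?thesis unfolding V_def using yX r by (auto intro!: exI[of _ "r / 2"])
    qed
    then show "\<exists>r>0. mball_of X x r \<subseteq> V Q" using r by (intro exI[of _ "r / 2"]) auto
  qed (auto simp: V_def)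
  let ?E = "V P" and ?F = "V (\<lambda>c. \<not> P c)"
  have cover: "?E \<union> ?F = topspace (mtopology_of X)"
  proof -
    have "x \<in> ?E \<union> ?F" if x: "x \<in> mspace X" for x
    proof -
      obtain r where r: "r > 0" "normal_radius X x r" using factor_space_normal_radius[OF X x] .
      have "P v" if "central X u" "central X v" "mdist X x u < r" "mdist X x v < r" "P u" for u v
        using normal_radius_geodesic[OF r(2), of u v] along[OF that(1,2) _ that(5)]
          that(3,4) centralX[OF that(1)] centralX[OF that(2)] x by auto
      then show ?thesis unfolding V_def using x r(1) by blast
    qed
    then show ?thesis unfolding V_def by auto
  qed
  have disj: "?E \<inter> ?F = {}"
  proof (rule ccontr)
    assume "?E \<inter> ?F \<noteq> {}"
    then obtain x r s where x: "x \<in> mspace X" and rs: "r > 0" "s > 0"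
      and 1: "\<And>c. central X c \<Longrightarrow> mdist X x c < r \<Longrightarrow> P c"
      and 2: "\<And>c. central X c \<Longrightarrow> mdist X x c < s \<Longrightarrow> \<not> P c" unfolding V_def by blast
    obtain c where "central X c" "mdist X x c < min r s"
      using central_dense[OF X x, of "min r s"] rs by auto
    then show False using 1 2 by auto
  qed
  have "connected_space (mtopology_of X)" using X unfolding factor_space_def by blast
  then have "?E = {} \<or> ?F = {}" using openV cover disj unfolding connected_space_eq by blast
  moreover have "x \<in> V Q \<Longrightarrow> central X x \<Longrightarrow> Q x" for x Q
    unfolding V_def by (auto simp: mdist_self dest!: spec[of _ x])
  ultimately show ?thesis using a b centralX cover by (metis UnE empty_iff topspace_mtopology_of)
qed

section \<open>Boxes and central points in a product\<close>

abbreviation points :: "nat \<Rightarrow> (nat \<Rightarrow> 'a metric) \<Rightarrow> (nat \<Rightarrow> 'a) set" where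
  "points m M \<equiv> \<Pi>\<^sub>E i\<in>{1..m}. mspace (M i)"

lemma mdist_le_sup_dist: "i \<in> {1..m} \<Longrightarrow> mdist (M i) (x i) (y i) \<le> sup_dist m M x y"
  unfolding sup_dist_def by (intro Max_ge) auto

lemma sup_dist_le_iff:
  "m \<ge> 1 \<Longrightarrow> sup_dist m M x y \<le> b \<longleftrightarrow> (\<forall>i\<in>{1..m}. mdist (M i) (x i) (y i) \<le> b)"
  unfolding sup_dist_def by (subst Max_le_iff) auto

lemma sup_dist_less_iff:
  "m \<ge> 1 \<Longrightarrow> sup_dist m M x y < b \<longleftrightarrow> (\<forall>i\<in>{1..m}. mdist (M i) (x i) (y i) < b)"
  unfolding sup_dist_def by (subst Max_less_iff) auto

lemma sup_dist_attained:
  assumes "m \<ge> 1"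
  shows "\<exists>i\<in>{1..m}. mdist (M i) (x i) (y i) = sup_dist m M x y"
proof -
  have "sup_dist m M x y \<in> (\<lambda>i. mdist (M i) (x i) (y i)) ` {1..m}"
    unfolding sup_dist_def using assms by (intro Max_in) auto
  then show ?thesis by auto
qed

lemma points_upd: "z \<in> points m M \<Longrightarrow> k \<in> {1..m} \<Longrightarrow> a \<in> mspace (M k) \<Longrightarrow> z(k := a) \<in> points m M"
  by (auto simp: PiE_iff extensional_def)

lemma sup_dist_upd:
  assumes m: "m \<ge> 1" and z: "z \<in> points m M" and k: "k \<in> {1..m}"
  shows "sup_dist m M (z(k := a)) (z(k := b)) = mdist (M k) a b"
proof (rule antisym)
  show "sup_dist m M (z(k := a)) (z(k := b)) \<le> mdist (M k) a b"
    unfolding sup_dist_le_iff[OF m] using mdist_self[OF PiE_mem[OF z]] by auto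
  show "mdist (M k) a b \<le> sup_dist m M (z(k := a)) (z(k := b))"
    using mdist_le_sup_dist[OF k, of M "z(k := a)" "z(k := b)"] by simp
qed

lemma uniform_radius:
  assumes "finite A" and "\<And>i. i \<in> A \<Longrightarrow> \<exists>r>0::real. \<forall>s. 0 < s \<and> s \<le> r \<longrightarrow> Q i s"
  shows "\<exists>r>0. \<forall>s. 0 < s \<and> s \<le> r \<longrightarrow> (\<forall>i\<in>A. Q i s)"
  using assms
proof (induction A)
  case empty
  then show ?case by (auto intro: exI[of _ 1])
next
  case (insert k A)
  obtain r where r: "r > 0" "\<forall>s. 0 < s \<and> s \<le> r \<longrightarrow> (\<forall>i\<in>A. Q i s)"
    using insert by auto
  obtain t where t: "t > 0" "\<forall>s. 0 < s \<and> s \<le> t \<longrightarrow> Q k s" using insert by blast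
  show ?case using r t by (intro exI[of _ "min r t"]) auto
qed

lemma normal_radius_mono:
  assumes "normal_radius X x r" and "0 < s" and "s \<le> r"
  shows "normal_radius X x s"
proof -
  have "mball_of X x s \<subseteq> mball_of X x r" using assms(3) by auto
  then show ?thesis using assms(1,2) unfolding normal_radius_def by (meson subsetD)
qed

lemma uniform_normal_radius:
  assumes "\<And>i. i \<in> {1..m} \<Longrightarrow> factor_space (M i)" and z: "z \<in> points m M"
  shows "\<exists>r>0. \<forall>i\<in>{1..m}. normal_radius (M i) (z i) r"
proof -
  have "\<exists>r>0. \<forall>s. 0 < s \<and> s \<le> r \<longrightarrow> normal_radius (M i) (z i) s" if i: "i \<in> {1..m}" for i
    using factor_space_normal_radius[OF assms(1)[OF i] PiE_mem[OF z i]] normal_radius_mono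
    by metis
  then have "\<exists>r>0. \<forall>s. 0 < s \<and> s \<le> r \<longrightarrow> (\<forall>i\<in>{1..m}. normal_radius (M i) (z i) s)"
    by (intro uniform_radius) auto
  then show ?thesis by blast
qed

definition central_point :: "nat \<Rightarrow> (nat \<Rightarrow> 'a metric) \<Rightarrow> (nat \<Rightarrow> 'a) \<Rightarrow> bool" where
  "central_point m M z \<longleftrightarrow> z \<in> points m M \<and> (\<forall>i\<in>{1..m}. central (M i) (z i))"

text \<open>Only points near \<open>z\<close> are compared, so the relation between \<open>i\<close> and \<open>j\<close> may depend on \<open>z\<close> until
  \<open>controls_global\<close> shows that on central points it does not.\<close>

definition controls ::
  "nat \<Rightarrow> (nat \<Rightarrow> 'a metric) \<Rightarrow> ((nat \<Rightarrow> 'a) \<Rightarrow> nat \<Rightarrow> 'b) \<Rightarrow> (nat \<Rightarrow> 'a) \<Rightarrow> nat \<Rightarrow> nat \<Rightarrow> bool" where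
  "controls m M f z i j \<longleftrightarrow>
     (\<exists>\<rho>>0. \<forall>w\<in>points m M. sup_dist m M z w < \<rho> \<and> w i = z i \<longrightarrow> f w j = f z j)"

lemma central_mspace: "central X c \<Longrightarrow> c \<in> mspace X"
  unfolding central_def by blast

lemma central_point_upd:
  "central_point m M z \<Longrightarrow> k \<in> {1..m} \<Longrightarrow> central (M k) b \<Longrightarrow> central_point m M (z(k := b))"
  unfolding central_point_def using points_upd central_mspace by (metis fun_upd_apply)

lemma central_point_dense:
  assumes m: "m \<ge> 1" and M: "\<And>i. i \<in> {1..m} \<Longrightarrow> factor_space (M i)"
    and z: "z \<in> points m M" and e: "e > 0"
  shows "\<exists>c. central_point m M c \<and> sup_dist m M z c < e"
proof -
  have "\<forall>i\<in>{1..m}. \<exists>c. central (M i) c \<and> mdist (M i) (z i) c < e"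
    using central_dense[OF M PiE_mem[OF z] e] by blast
  then obtain c where c: "\<forall>i\<in>{1..m}. central (M i) (c i) \<and> mdist (M i) (z i) (c i) < e"
    by (rule bchoice[THEN exE])
  show ?thesis
    using c unfolding central_point_def sup_dist_less_iff[OF m]
    by (intro exI[of _ "restrict c {1..m}"]) (auto intro: central_mspace)
qed

section \<open>How an isometry permutes the coordinates\<close>

text \<open>The isometry comes together with its inverse, so that every lemma also applies with the two
  products exchanged.\<close>

locale sup_isometry =
  fixes m n :: nat and M :: "nat \<Rightarrow> 'a metric" and N :: "nat \<Rightarrow> 'b metric"
    and f :: "(nat \<Rightarrow> 'a) \<Rightarrow> (nat \<Rightarrow> 'b)" and g :: "(nat \<Rightarrow> 'b) \<Rightarrow> (nat \<Rightarrow> 'a)"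
  assumes m: "m \<ge> 1" and n: "n \<ge> 1"
    and M: "\<And>i. i \<in> {1..m} \<Longrightarrow> factor_space (M i)"
    and N: "\<And>j. j \<in> {1..n} \<Longrightarrow> factor_space (N j)"
    and f_in: "x \<in> points m M \<Longrightarrow> f x \<in> points n N"
    and g_in: "y \<in> points n N \<Longrightarrow> g y \<in> points m M"
    and gf: "x \<in> points m M \<Longrightarrow> g (f x) = x"
    and fg: "y \<in> points n N \<Longrightarrow> f (g y) = y"
    and f_dist: "x \<in> points m M \<Longrightarrow> x' \<in> points m M \<Longrightarrow>
      sup_dist n N (f x) (f x') = sup_dist m M x x'"
begin

lemma inverse: "sup_isometry n m N M g f"
proof
  fix y y' assume "y \<in> points n N" "y' \<in> points n N"
  then show "sup_dist m M (g y) (g y') = sup_dist n N y y'"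
    using f_dist[of "g y" "g y'"] g_in fg by metis
qed (use m n M N f_in g_in gf fg in auto)

lemma mdist_f_le:
  "x \<in> points m M \<Longrightarrow> x' \<in> points m M \<Longrightarrow> j \<in> {1..n} \<Longrightarrow>
     mdist (N j) (f x j) (f x' j) \<le> sup_dist m M x x'"
  using mdist_le_sup_dist[of j n N "f x" "f x'"] f_dist[of x x'] by simp

text \<open>Spreading all coordinates of \<open>z\<close> apart by \<open>e\<close> gives \<open>p\<close> and \<open>q\<close> whose box is \<open>{z}\<close>, so the box of \<open>f p\<close>
  and \<open>f q\<close> is \<open>{f z}\<close>. If some coordinate distance of \<open>f p\<close> and \<open>f q\<close> were less than \<open>2 * e\<close>, the lens
  in that coordinate would have a second point. So \<open>f z\<close> bisects a segment of length \<open>2 * e\<close> in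
  every coordinate.\<close>

lemma central_point_image:
  assumes "central_point m M z"
  shows "central_point n N (f z)"
proof -
  have z: "z \<in> points m M" and c: "\<And>i. i \<in> {1..m} \<Longrightarrow> central (M i) (z i)"
    using assms unfolding central_point_def by auto
  note fz = f_in[OF z]
  obtain r1 where r1: "r1 > 0" "\<forall>i\<in>{1..m}. normal_radius (M i) (z i) r1"
    using uniform_normal_radius[OF M z] by blast
  obtain r2 where r2: "r2 > 0" "\<forall>j\<in>{1..n}. normal_radius (N j) (f z j) r2"
    using uniform_normal_radius[OF N fz] by blast
  define Q where "Q i e \<longleftrightarrow> (\<exists>a\<in>mspace (M i). \<exists>b\<in>mspace (M i).
      mdist (M i) a (z i) = e \<and> mdist (M i) (z i) b = e \<and> mdist (M i) a b = 2 * e)" for i e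
  have "\<exists>r>0. \<forall>s. 0 < s \<and> s \<le> r \<longrightarrow> Q i s" if i: "i \<in> {1..m}" for i
  proof -
    obtain d where d: "d > 0" "\<forall>e. 0 < e \<and> e < d \<longrightarrow> Q i e"
      using c[OF i] unfolding central_def Q_def by auto
    then show ?thesis by (intro exI[of _ "d / 2"]) auto
  qed
  then have "\<exists>r>0. \<forall>s. 0 < s \<and> s \<le> r \<longrightarrow> (\<forall>i\<in>{1..m}. Q i s)"
    by (intro uniform_radius) auto
  then obtain d where d: "d > 0" "\<And>s i. 0 < s \<Longrightarrow> s \<le> d \<Longrightarrow> i \<in> {1..m} \<Longrightarrow> Q i s" by blast
  have seg: "\<exists>a\<in>mspace (N j). \<exists>b\<in>mspace (N j). mdist (N j) a (f z j) = e \<and>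
      mdist (N j) (f z j) b = e \<and> mdist (N j) a b = 2 * e"
    if j: "j \<in> {1..n}" and e: "0 < e" "e < min d (min r1 r2)" for j e
  proof -
    have "\<forall>i\<in>{1..m}. \<exists>p. fst p \<in> mspace (M i) \<and> snd p \<in> mspace (M i) \<and>
        mdist (M i) (fst p) (z i) = e \<and> mdist (M i) (z i) (snd p) = e \<and>
        mdist (M i) (fst p) (snd p) = 2 * e"
      using d(2)[of e] e unfolding Q_def by fastforce
    then obtain h where h: "\<forall>i\<in>{1..m}. fst (h i) \<in> mspace (M i) \<and> snd (h i) \<in> mspace (M i) \<and>
        mdist (M i) (fst (h i)) (z i) = e \<and> mdist (M i) (z i) (snd (h i)) = e \<and>
        mdist (M i) (fst (h i)) (snd (h i)) = 2 * e"
      by (rule bchoice[THEN exE])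
    define p where "p = (\<lambda>i\<in>{1..m}. fst (h i))"
    define q where "q = (\<lambda>i\<in>{1..m}. snd (h i))"
    have p: "p \<in> points m M" and q: "q \<in> points m M" unfolding p_def q_def using h by auto
    have pi: "mdist (M i) (p i) (z i) = e" and qi: "mdist (M i) (z i) (q i) = e"
      and pqi: "mdist (M i) (p i) (q i) = 2 * e" if "i \<in> {1..m}" for i
      unfolding p_def q_def using h that by auto
    have pz: "sup_dist m M p z \<le> e" and zq: "sup_dist m M z q \<le> e"
      and pq: "sup_dist m M p q \<le> 2 * e"
      unfolding sup_dist_le_iff[OF m] using pi qi pqi by auto
    note fp = f_in[OF p] and fq = f_in[OF q]
    have a: "mdist (N j) (f p j) (f z j) \<le> e" using mdist_f_le[OF p z j] pz by simp
    have b: "mdist (N j) (f z j) (f q j) \<le> e" using mdist_f_le[OF z q j] zq by simp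
    have "mdist (N j) (f p j) (f q j) \<le> 2 * e" using mdist_f_le[OF p q j] pq by simp
    moreover have "\<not> mdist (N j) (f p j) (f q j) < 2 * e"
    proof
      assume less: "mdist (N j) (f p j) (f q j) < 2 * e"
      have "f p j \<in> mball_of (N j) (f z j) r2" "f q j \<in> mball_of (N j) (f z j) r2"
        using a b e PiE_mem[OF fz j] PiE_mem[OF fp j] PiE_mem[OF fq j]
        by (auto simp: mdist_commute[of "N j" "f z j" "f p j"])
      then obtain c where c: "c \<in> lens (N j) (f p j) (f q j) e" "c \<noteq> f z j"
        using lens_nontrivial[OF N[OF j] _ _ _ less] r2(2) j by blast
      \<comment> \<open>A second point of the box of \<open>f p\<close> and \<open>f q\<close>; its preimage lies in the box of \<open>p\<close> and \<open>q\<close>.\<close>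
      let ?w = "(f z)(j := c)"
      have w: "?w \<in> points n N" using points_upd[OF fz j] c unfolding lens_def by auto
      have fpw: "sup_dist n N (f p) ?w \<le> e" "sup_dist n N ?w (f q) \<le> e"
        unfolding sup_dist_le_iff[OF n]
        using c mdist_f_le[OF p z] mdist_f_le[OF z q] pz zq unfolding lens_def by fastforce+
      note x = g_in[OF w]
      have px: "sup_dist m M p (g ?w) \<le> e" and xq: "sup_dist m M (g ?w) q \<le> e"
        using fpw f_dist[OF p x] f_dist[OF x q] fg[OF w] by auto
      have "g ?w = z"
      proof (rule PiE_ext[OF x z])
        fix i assume i: "i \<in> {1..m}"
        have px': "mdist (M i) (p i) (g ?w i) \<le> e" and xq': "mdist (M i) (g ?w i) (q i) \<le> e"
          using px xq mdist_le_sup_dist[OF i, of M p "g ?w"] mdist_le_sup_dist[OF i, of M "g ?w" q]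
          by linarith+
        show "g ?w i = z i"
        proof (rule lens_unique[of "M i" "z i" r1 "p i" "q i" e])
          show "normal_radius (M i) (z i) r1" using r1 i by blast
          show "p i \<in> mball_of (M i) (z i) r1" "q i \<in> mball_of (M i) (z i) r1"
            using pi[OF i] qi[OF i] e PiE_mem[OF z i] PiE_mem[OF p i] PiE_mem[OF q i]
            by (auto simp: mdist_commute[of "M i" "z i" "p i"])
          show "mdist (M i) (p i) (q i) = 2 * e" by (rule pqi[OF i])
          show "g ?w i \<in> lens (M i) (p i) (q i) e" "z i \<in> lens (M i) (p i) (q i) e"
            unfolding lens_def using px' xq' pi[OF i] qi[OF i] PiE_mem[OF x i] PiE_mem[OF z i] by auto
        qed
      qed
      then have "?w = f z" using fg[OF w] by simp
      then show False using c(2) by (metis fun_upd_same)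
    qed
    moreover have "mdist (N j) (f p j) (f q j) \<le> mdist (N j) (f p j) (f z j) + mdist (N j) (f z j) (f q j)"
      by (rule mdist_triangle[OF PiE_mem[OF fp j] PiE_mem[OF fz j] PiE_mem[OF fq j]])
    ultimately have "mdist (N j) (f p j) (f z j) = e" "mdist (N j) (f z j) (f q j) = e"
        "mdist (N j) (f p j) (f q j) = 2 * e"
      using a b by linarith+
    then show ?thesis using PiE_mem[OF fp j] PiE_mem[OF fq j] by blast
  qed
  have "central (N j) (f z j)" if j: "j \<in> {1..n}" for j
    unfolding central_def using PiE_mem[OF fz j] seg[OF j] d(1) r1(1) r2(1)
    by (intro conjI exI[of _ "min d (min r1 r2)"]) auto
  then show ?thesis unfolding central_point_def using fz by blast
qed

text \<open>Spreading only coordinate \<open>i\<close> apart gives a box that contains all points near \<open>z\<close> with the same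
  \<open>i\<close>-th coordinate. In a coordinate \<open>j\<close> that realises the distance of \<open>f p\<close> and \<open>f q\<close>, the image box
  is a single point.\<close>

lemma controls_exists:
  assumes z: "z \<in> points m M" and i: "i \<in> {1..m}" and c: "central (M i) (z i)"
  shows "\<exists>j\<in>{1..n}. controls m M f z i j"
proof -
  note fz = f_in[OF z]
  obtain r where r: "r > 0" "\<forall>j\<in>{1..n}. normal_radius (N j) (f z j) r"
    using uniform_normal_radius[OF N fz] by blast
  obtain d where d: "d > 0" "\<And>e. 0 < e \<Longrightarrow> e < d \<Longrightarrow> \<exists>a\<in>mspace (M i). \<exists>b\<in>mspace (M i).
      mdist (M i) a (z i) = e \<and> mdist (M i) (z i) b = e \<and> mdist (M i) a b = 2 * e"
    using c unfolding central_def by blast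
  define e where "e = min d r / 2"
  have e: "0 < e" "e < d" "e < r" unfolding e_def using d(1) r(1) by auto
  obtain a b where a: "a \<in> mspace (M i)" and b: "b \<in> mspace (M i)"
    and az: "mdist (M i) a (z i) = e" and zb: "mdist (M i) (z i) b = e"
    and ab: "mdist (M i) a b = 2 * e" using d(2)[OF e(1,2)] by blast
  let ?p = "z(i := a)" and ?q = "z(i := b)"
  have p: "?p \<in> points m M" and q: "?q \<in> points m M" using points_upd[OF z i] a b by auto
  note fp = f_in[OF p] and fq = f_in[OF q]
  have "sup_dist n N (f ?p) (f ?q) = 2 * e"
    using f_dist[OF p q] sup_dist_upd[OF m z i] ab by simp
  then obtain j where j: "j \<in> {1..n}" and pq: "mdist (N j) (f ?p j) (f ?q j) = 2 * e"
    using sup_dist_attained[OF n, of N "f ?p" "f ?q"] by auto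
  have lens: "f w j \<in> lens (N j) (f ?p j) (f ?q j) e"
    if w: "w \<in> points m M" and zw: "sup_dist m M z w < e" and wi: "w i = z i" for w
  proof -
    have zwk: "mdist (M k) (z k) (w k) < e" if "k \<in> {1..m}" for k
      using zw that unfolding sup_dist_less_iff[OF m] by blast
    have "sup_dist m M ?p w \<le> e" "sup_dist m M w ?q \<le> e"
      unfolding sup_dist_le_iff[OF m] using zwk az zb wi
      by (auto simp: less_imp_le mdist_commute[of _ "w _" "z _"])
    then show ?thesis
      using mdist_f_le[OF p w j] mdist_f_le[OF w q j] PiE_mem[OF f_in[OF w] j] unfolding lens_def by auto
  qed
  have zz: "sup_dist m M z z < e"
    unfolding sup_dist_less_iff[OF m] using mdist_self[OF PiE_mem[OF z]] e by auto
  have zl: "f z j \<in> lens (N j) (f ?p j) (f ?q j) e" using lens[OF z zz] by simp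
  have ball: "f ?p j \<in> mball_of (N j) (f z j) r" "f ?q j \<in> mball_of (N j) (f z j) r"
    using zl e PiE_mem[OF fz j] PiE_mem[OF fp j] PiE_mem[OF fq j] unfolding lens_def
    by (auto simp: mdist_commute[of "N j" "f z j" "f ?p j"])
  have "f w j = f z j"
    if "w \<in> points m M" "sup_dist m M z w < e" "w i = z i" for w
    using lens_unique[OF _ ball pq lens[OF that] zl] r(2) j by blast
  then show ?thesis unfolding controls_def using j e by blast
qed

text \<open>Otherwise fixing coordinate \<open>i\<close> near \<open>z\<close> would also fix coordinate \<open>k\<close>, although \<open>z k\<close> is not isolated
  in its factor.\<close>

lemma controls_comp:
  assumes z: "z \<in> points m M" and i: "i \<in> {1..m}" and k: "k \<in> {1..m}"
    and 1: "controls m M f z i j" and 2: "controls n N g (f z) j k"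
  shows "i = k"
proof (rule ccontr)
  assume ik: "i \<noteq> k"
  obtain r where r: "r > 0" "\<And>w. w \<in> points m M \<Longrightarrow> sup_dist m M z w < r \<Longrightarrow> w i = z i \<Longrightarrow> f w j = f z j"
    using 1 unfolding controls_def by blast
  obtain s where s: "s > 0" "\<And>v. v \<in> points n N \<Longrightarrow> sup_dist n N (f z) v < s \<Longrightarrow> v j = f z j \<Longrightarrow>
      g v k = g (f z) k"
    using 2 unfolding controls_def by blast
  obtain y where y: "y \<in> mspace (M k)" "y \<noteq> z k" "mdist (M k) (z k) y < min r s"
    using factor_space_no_isolated[OF M[OF k] PiE_mem[OF z k], of "min r s"] r s by auto
  let ?w = "z(k := y)"
  have w: "?w \<in> points m M" by (rule points_upd[OF z k y(1)])
  have zw: "sup_dist m M z ?w < min r s" using sup_dist_upd[OF m z k, of "z k" y] y by simp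
  have "f ?w j = f z j" using r(2)[OF w] zw ik by simp
  then have "g (f ?w) k = g (f z) k" using s(2)[OF f_in[OF w]] zw f_dist[OF z w] by simp
  then show False using gf[OF w] gf[OF z] y(2) by simp
qed

lemma controls_inverse:
  assumes z: "central_point m M z" and i: "i \<in> {1..m}" and j: "j \<in> {1..n}"
    and c: "controls m M f z i j"
  shows "controls n N g (f z) j i"
proof -
  have zX: "z \<in> points m M" using z unfolding central_point_def by blast
  obtain k where "k \<in> {1..m}" "controls n N g (f z) j k"
    using sup_isometry.controls_exists[OF inverse f_in[OF zX] j] central_point_image[OF z] j
    unfolding central_point_def by blast
  then show ?thesis using controls_comp[OF zX i _ c] by blast
qed

lemma controls_inj:
  assumes z: "central_point m M z" and i: "i \<in> {1..m}" "i' \<in> {1..m}" and j: "j \<in> {1..n}"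
    and "controls m M f z i j" and "controls m M f z i' j"
  shows "i = i'"
  using assms controls_comp[OF _ i] controls_inverse[OF z i(2) j] unfolding central_point_def by blast

lemma controls_fun:
  assumes z: "central_point m M z" and i: "i \<in> {1..m}" and j: "j \<in> {1..n}" "j' \<in> {1..n}"
    and "controls m M f z i j" and "controls m M f z i j'"
  shows "j = j'"
proof -
  have zX: "z \<in> points m M" using z unfolding central_point_def by blast
  show ?thesis
    using sup_isometry.controls_inj[OF inverse central_point_image[OF z] j i]
      sup_isometry.controls_comp[OF inverse f_in[OF zX] j, of i]
      controls_inverse[OF z i] assms gf[OF zX] by auto
qed

lemma controls_surj:
  assumes z: "central_point m M z" and j: "j \<in> {1..n}"
  shows "\<exists>i\<in>{1..m}. controls m M f z i j"
proof -
  have zX: "z \<in> points m M" using z unfolding central_point_def by blast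
  obtain i where "i \<in> {1..m}" "controls n N g (f z) j i"
    using sup_isometry.controls_exists[OF inverse f_in[OF zX] j] central_point_image[OF z] j
    unfolding central_point_def by blast
  then show ?thesis
    using sup_isometry.controls_inverse[OF inverse central_point_image[OF z] j, of i] gf[OF zX] by auto
qed

text \<open>With \<open>i\<close> fixed and \<open>k\<close> varying, let \<open>j'\<close> be the coordinate controlled by \<open>i\<close> at the current point. Small
  changes of coordinate \<open>k\<close> leave coordinate \<open>i\<close> alone, hence keep the \<open>j'\<close>-th coordinate of the value,
  and \<open>i\<close> still controls \<open>j'\<close>. So the assertion about \<open>j\<close> is locally constant.\<close>

lemma controls_step_other:
  assumes z: "central_point m M z" and k: "k \<in> {1..m}" and b: "central (M k) b"
    and i: "i \<in> {1..m}" and j: "j \<in> {1..n}" and ik: "i \<noteq> k" and c: "controls m M f z i j"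
  shows "controls m M f (z(k := b)) i j \<and> f (z(k := b)) j = f z j"
proof -
  have zX: "z \<in> points m M" using z unfolding central_point_def by blast
  let ?P = "\<lambda>c. controls m M f (z(k := c)) i j \<and> f (z(k := c)) j = f z j"
  have "?P (z k) = ?P b"
  proof (rule central_locally_constant[OF M[OF k]])
    show "central (M k) (z k)" using z k unfolding central_point_def by blast
    show "central (M k) b" by (rule b)
    fix c assume cc: "central (M k) c"
    let ?y = "z(k := c)"
    have y: "central_point m M ?y" by (rule central_point_upd[OF z k cc])
    have yX: "?y \<in> points m M" using y unfolding central_point_def by blast
    obtain j' where j': "j' \<in> {1..n}" and cj': "controls m M f ?y i j'"
      using controls_exists[OF yX i] y i unfolding central_point_def by blast
    obtain r where r: "r > 0"
      "\<And>w. w \<in> points m M \<Longrightarrow> sup_dist m M ?y w < r \<Longrightarrow> w i = ?y i \<Longrightarrow> f w j' = f ?y j'"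
      using cj' unfolding controls_def by blast
    have "?P c' = ?P c" if cc': "central (M k) c'" and near: "mdist (M k) c c' < r" for c'
    proof -
      let ?y' = "z(k := c')"
      have y': "central_point m M ?y'" by (rule central_point_upd[OF z k cc'])
      have yX': "?y' \<in> points m M" using y' unfolding central_point_def by blast
      have yy': "sup_dist m M ?y ?y' = mdist (M k) c c'" by (rule sup_dist_upd[OF m zX k])
      have eq: "f ?y' j' = f ?y j'" using r(2)[OF yX'] yy' near ik by simp
      have "controls m M f ?y' i j'"
        unfolding controls_def
      proof (intro exI[of _ "r - mdist (M k) c c'"] conjI ballI impI)
        fix w assume w: "w \<in> points m M" and ww: "sup_dist m M ?y' w < r - mdist (M k) c c' \<and> w i = ?y' i"
        have "sup_dist m M ?y w \<le> sup_dist m M ?y ?y' + sup_dist m M ?y' w"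
          by (rule Metric_space.triangle[OF Metric_space_sup_product[OF m] yX yX' w])
        then have "f w j' = f ?y j'" using r(2)[OF w] ww yy' ik by auto
        then show "f w j' = f ?y' j'" using eq by simp
      qed (use near in simp)
      then show ?thesis
        using controls_fun[OF y i j' j cj'] controls_fun[OF y' i j' j] cj' eq by metis
    qed
    then show "\<exists>r>0. \<forall>c'. central (M k) c' \<and> mdist (M k) c c' < r \<longrightarrow> ?P c' = ?P c"
      using r(1) by blast
  qed
  then show ?thesis using c by simp
qed

text \<open>Coordinate \<open>k\<close> itself keeps its partner because all other coordinates keep theirs.\<close>

lemma controls_step:
  assumes z: "central_point m M z" and k: "k \<in> {1..m}" and b: "central (M k) b"
    and i: "i \<in> {1..m}" and j: "j \<in> {1..n}" and c: "controls m M f z i j"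
  shows "controls m M f (z(k := b)) i j"
proof (cases "i = k")
  case False
  then show ?thesis using controls_step_other[OF z k b i j _ c] by blast
next
  case True
  let ?y = "z(k := b)"
  have y: "central_point m M ?y" by (rule central_point_upd[OF z k b])
  obtain i' where i': "i' \<in> {1..m}" "controls m M f ?y i' j" using controls_surj[OF y j] by blast
  have "i' = k"
  proof (rule ccontr)
    assume "i' \<noteq> k"
    moreover have "central (M k) (z k)" using z k unfolding central_point_def by blast
    ultimately have "controls m M f (?y(k := z k)) i' j"
      using controls_step_other[OF y k _ i'(1) j _ i'(2)] by blast
    then show False using controls_inj[OF z i i'(1) j c] True \<open>i' \<noteq> k\<close> by simp
  qed
  then show ?thesis using i' True by simp
qed

lemma controls_global:
  assumes z: "central_point m M z" and w: "central_point m M w"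
    and i: "i \<in> {1..m}" and j: "j \<in> {1..n}" and c: "controls m M f z i j"
  shows "controls m M f w i j \<and> (z i = w i \<longrightarrow> f w j = f z j)"
proof -
  define h where "h l = (\<lambda>k. if k \<in> {1..l} then w k else z k)" for l
  have "central_point m M (h l) \<and> controls m M f (h l) i j \<and> (z i = w i \<longrightarrow> f (h l) j = f z j)"
    if "l \<le> m" for l
    using that
  proof (induction l)
    case 0
    have "h 0 = z" unfolding h_def by auto
    then show ?case using z c by simp
  next
    case (Suc l)
    then have IH: "central_point m M (h l)" "controls m M f (h l) i j"
        "z i = w i \<longrightarrow> f (h l) j = f z j" and k: "Suc l \<in> {1..m}" by auto
    have step: "h (Suc l) = (h l)(Suc l := w (Suc l))" unfolding h_def by (auto simp: fun_eq_iff le_Suc_eq)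
    have wk: "central (M (Suc l)) (w (Suc l))" using w k unfolding central_point_def by blast
    have "z i = w i \<longrightarrow> f (h (Suc l)) j = f (h l) j"
    proof (cases "i = Suc l")
      case True
      then have "z i = w i \<longrightarrow> h (Suc l) = h l" unfolding step by (simp add: h_def fun_eq_iff)
      then show ?thesis by auto
    next
      case False
      then show ?thesis using controls_step_other[OF IH(1) k wk i j _ IH(2)] step by simp
    qed
    then show ?case
      using IH(3) controls_step[OF IH(1) k wk i j IH(2)] central_point_upd[OF IH(1) k wk] step
      by metis
  qed
  moreover have "h m = w"
    using PiE_arb[of z "{1..m}"] PiE_arb[of w "{1..m}"] z w unfolding central_point_def h_def
    by (force simp: fun_eq_iff)
  ultimately show ?thesis by (metis order_refl)
qed

text \<open>Two points with the same \<open>i\<close>-th coordinate are approximated by central points that again share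
  their \<open>i\<close>-th coordinate.\<close>

lemma coordinate_determined:
  assumes z0: "central_point m M z0" and i: "i \<in> {1..m}" and j: "j \<in> {1..n}"
    and c: "controls m M f z0 i j"
    and z: "z \<in> points m M" and w: "w \<in> points m M" and zw: "z i = w i"
  shows "f z j = f w j"
proof (rule ccontr)
  assume ne: "f z j \<noteq> f w j"
  have fz: "f z j \<in> mspace (N j)" and fw: "f w j \<in> mspace (N j)"
    using PiE_mem[OF f_in[OF z] j] PiE_mem[OF f_in[OF w] j] by auto
  define d where "d = mdist (N j) (f z j) (f w j) / 2"
  have d: "d > 0"
    unfolding d_def using mdist_zero[OF fz fw] ne mdist_nonneg[of "N j" "f z j" "f w j"]
    by (metis half_gt_zero order_le_imp_less_or_eq)
  obtain z' where z': "central_point m M z'" "sup_dist m M z z' < d"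
    using central_point_dense[OF m M z d] by blast
  obtain v where v: "central_point m M v" "sup_dist m M w v < d"
    using central_point_dense[OF m M w d] by blast
  let ?w' = "v(i := z' i)"
  have w': "central_point m M ?w'"
    using central_point_upd[OF v(1) i] z' i unfolding central_point_def by blast
  have ww': "sup_dist m M w ?w' < d"
    using z'(2) v(2) i zw unfolding sup_dist_less_iff[OF m] by (metis fun_upd_apply)
  have zX': "z' \<in> points m M" and wX': "?w' \<in> points m M"
    using z' w' unfolding central_point_def by auto
  have eq: "f ?w' j = f z' j"
    using controls_global[OF z'(1) w' i j] controls_global[OF z0 z'(1) i j c] by simp
  have fz': "f z' j \<in> mspace (N j)" using PiE_mem[OF f_in[OF zX'] j] .
  have "mdist (N j) (f z j) (f w j) \<le> mdist (N j) (f z j) (f z' j) + mdist (N j) (f z' j) (f w j)"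
    by (rule mdist_triangle[OF fz fz' fw])
  moreover have "mdist (N j) (f z j) (f z' j) < d"
    using mdist_f_le[OF z zX' j] z'(2) by simp
  moreover have "mdist (N j) (f z' j) (f w j) < d"
    using mdist_f_le[OF w wX' j] ww' eq by (simp add: mdist_commute)
  ultimately show False unfolding d_def by simp
qed

theorem reducible:
  "m = n \<and>
    (\<exists>\<pi> F. \<pi> permutes {1..m} \<and>
       (\<forall>i\<in>{1..m}. metric_isometry (M i) (N (\<pi> i)) (F i)) \<and>
       (\<forall>\<alpha>\<in>points m M. f \<alpha> = (\<lambda>j\<in>{1..m}. F (inv \<pi> j) (\<alpha> (inv \<pi> j)))))"
proof -
  have "\<forall>i\<in>{1..m}. \<exists>x. x \<in> mspace (M i)" using M unfolding factor_space_def by blast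
  then obtain x where "\<forall>i\<in>{1..m}. x i \<in> mspace (M i)" by (rule bchoice[THEN exE])
  then have "restrict x {1..m} \<in> points m M" by auto
  from central_point_dense[OF m M this, of 1]
  obtain z where z: "central_point m M z" by auto
  have zX: "z \<in> points m M" using z unfolding central_point_def by blast
  note fz = f_in[OF zX]
  have "\<forall>i\<in>{1..m}. \<exists>j. j \<in> {1..n} \<and> controls m M f z i j"
    using controls_exists[OF zX] z unfolding central_point_def by blast
  then obtain \<sigma> where \<sigma>: "\<forall>i\<in>{1..m}. \<sigma> i \<in> {1..n} \<and> controls m M f z i (\<sigma> i)"
    by (rule bchoice[THEN exE])
  have bij: "bij_betw \<sigma> {1..m} {1..n}"
    unfolding bij_betw_def
  proof
    show "inj_on \<sigma> {1..m}"
    proof (rule inj_onI)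
      fix i i' assume i: "i \<in> {1..m}" "i' \<in> {1..m}" "\<sigma> i = \<sigma> i'"
      then have "controls m M f z i (\<sigma> i)" "controls m M f z i' (\<sigma> i)" "\<sigma> i \<in> {1..n}"
        using \<sigma> by metis+
      then show "i = i'" using controls_inj[OF z i(1,2)] by blast
    qed
    show "\<sigma> ` {1..m} = {1..n}"
    proof
      show "\<sigma> ` {1..m} \<subseteq> {1..n}" using \<sigma> by blast
      show "{1..n} \<subseteq> \<sigma> ` {1..m}"
      proof
        fix j assume j: "j \<in> {1..n}"
        then obtain i where i: "i \<in> {1..m}" "controls m M f z i j" using controls_surj[OF z] by blast
        then have "\<sigma> i = j" using controls_fun[OF z i(1) _ j] \<sigma> by blast
        then show "j \<in> \<sigma> ` {1..m}" using i by blast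
      qed
    qed
  qed
  then have mn: "m = n" using bij_betw_same_card by fastforce
  \<comment> \<open>The controlled coordinates are known on \<open>{1..m}\<close> only; a permutation of \<open>{1..m}\<close> fixes all other indices.\<close>
  define \<pi> where "\<pi> i = (if i \<in> {1..m} then \<sigma> i else i)" for i
  have perm: "\<pi> permutes {1..m}"
  proof (rule bij_imp_permutes)
    show "bij_betw \<pi> {1..m} {1..m}"
      using bij mn bij_betw_cong[of "{1..m}" \<pi> \<sigma> "{1..m}"] by (simp add: \<pi>_def)
  qed (auto simp: \<pi>_def)
  define F where "F i a = f (z(i := a)) (\<sigma> i)" for i a
  have F: "f x (\<sigma> i) = F i (x i)" if i: "i \<in> {1..m}" and x: "x \<in> points m M" for i x
    unfolding F_def
    using coordinate_determined[OF z i _ _ x points_upd[OF zX i PiE_mem[OF x i]]] \<sigma> i by auto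
  have G: "g y i = g y' i" if i: "i \<in> {1..m}" and "y \<in> points n N" "y' \<in> points n N"
    "y (\<sigma> i) = y' (\<sigma> i)" for i y y'
    using sup_isometry.coordinate_determined[OF inverse central_point_image[OF z] _ i
        controls_inverse[OF z i]] \<sigma> that by blast
  have iso: "metric_isometry (M i) (N (\<pi> i)) (F i)" if i: "i \<in> {1..m}" for i
  proof -
    let ?j = "\<sigma> i"
    have j: "?j \<in> {1..n}" using \<sigma> i by blast
    have Fin: "F i a \<in> mspace (N ?j)" if "a \<in> mspace (M i)" for a
      unfolding F_def using PiE_mem[OF f_in[OF points_upd[OF zX i that]] j] .
    have dist: "mdist (N ?j) (F i a) (F i b) = mdist (M i) a b"
      if a: "a \<in> mspace (M i)" and b: "b \<in> mspace (M i)" for a b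
    proof (rule antisym)
      note za = points_upd[OF zX i a] and zb = points_upd[OF zX i b]
      show "mdist (N ?j) (F i a) (F i b) \<le> mdist (M i) a b"
        unfolding F_def using mdist_f_le[OF za zb j] sup_dist_upd[OF m zX i] by simp
      \<comment> \<open>Varying only coordinate \<open>?j\<close> of the value gives preimages with \<open>i\<close>-th coordinates \<open>a\<close> and \<open>b\<close>.\<close>
      let ?y = "(f z)(?j := F i a)" and ?y' = "(f z)(?j := F i b)"
      have y: "?y \<in> points n N" and y': "?y' \<in> points n N"
        using points_upd[OF fz j] Fin a b by auto
      have "g ?y i = a" using G[OF i y f_in[OF za]] gf[OF za] unfolding F_def by simp
      moreover have "g ?y' i = b" using G[OF i y' f_in[OF zb]] gf[OF zb] unfolding F_def by simp
      ultimately show "mdist (M i) a b \<le> mdist (N ?j) (F i a) (F i b)"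
        using sup_isometry.mdist_f_le[OF inverse y y' i] sup_dist_upd[OF n fz j] by simp
    qed
    have "bij_betw (F i) (mspace (M i)) (mspace (N ?j))"
      unfolding bij_betw_def
    proof
      show "inj_on (F i) (mspace (M i))"
        using dist mdist_zero Fin by (metis inj_onI)
      have "b \<in> F i ` mspace (M i)" if b: "b \<in> mspace (N ?j)" for b
      proof -
        let ?y = "(f z)(?j := b)"
        have y: "?y \<in> points n N" by (rule points_upd[OF fz j b])
        have "F i (g ?y i) = b" using F[OF i g_in[OF y]] fg[OF y] by simp
        then show ?thesis using PiE_mem[OF g_in[OF y] i] by (metis imageI)
      qed
      then show "F i ` mspace (M i) = mspace (N ?j)" using Fin by blast
    qed
    then show ?thesis unfolding metric_isometry_def \<pi>_def using dist i by simp
  qed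
  have "f \<alpha> = (\<lambda>j\<in>{1..m}. F (inv \<pi> j) (\<alpha> (inv \<pi> j)))" if \<alpha>: "\<alpha> \<in> points m M" for \<alpha>
  proof
    fix j
    show "f \<alpha> j = (\<lambda>j\<in>{1..m}. F (inv \<pi> j) (\<alpha> (inv \<pi> j))) j"
    proof (cases "j \<in> {1..m}")
      case True
      then have i: "inv \<pi> j \<in> {1..m}" using permutes_in_image[OF permutes_inv[OF perm]] by blast
      moreover have "\<sigma> (inv \<pi> j) = j"
        using permutes_inverses(1)[OF perm, of j] i unfolding \<pi>_def by simp
      ultimately show ?thesis using F[OF i \<alpha>] True by simp
    next
      case False
      then show ?thesis using PiE_arb[OF f_in[OF \<alpha>], of j] mn by auto
    qed
  qed
  then show ?thesis using mn perm iso by blast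
qed

end

section \<open>Reducibility\<close>

theorem mainTheorem1:
  fixes m n :: nat
    and M :: "nat \<Rightarrow> 'a metric" and N :: "nat \<Rightarrow> 'b metric"
    and f :: "(nat \<Rightarrow> 'a) \<Rightarrow> (nat \<Rightarrow> 'b)"
  assumes "m \<ge> 1" and "n \<ge> 1"
    and "\<And>i. i \<in> {1..m} \<Longrightarrow> path_connected_space (mtopology_of (M i))"
    and "\<And>i. i \<in> {1..m} \<Longrightarrow> locally_uniquely_geodesic (M i)"
    and "\<And>i. i \<in> {1..m} \<Longrightarrow> mspace (M i) \<noteq> {}"
    and "\<And>i. i \<in> {1..m} \<Longrightarrow> \<nexists>x. mspace (M i) = {x}"
    and "\<And>j. j \<in> {1..n} \<Longrightarrow> path_connected_space (mtopology_of (N j))"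
    and "\<And>j. j \<in> {1..n} \<Longrightarrow> locally_uniquely_geodesic (N j)"
    and "\<And>j. j \<in> {1..n} \<Longrightarrow> mspace (N j) \<noteq> {}"
    and "\<And>j. j \<in> {1..n} \<Longrightarrow> \<nexists>x. mspace (N j) = {x}"
    and "metric_isometry (sup_product m M) (sup_product n N) f"
  shows "m = n \<and>
    (\<exists>\<pi> F. \<pi> permutes {1..m} \<and>
       (\<forall>i\<in>{1..m}. metric_isometry (M i) (N (\<pi> i)) (F i)) \<and>
       (\<forall>\<alpha>\<in>(\<Pi>\<^sub>E i\<in>{1..m}. mspace (M i)).
          f \<alpha> = (\<lambda>j\<in>{1..m}. F (inv \<pi> j) (\<alpha> (inv \<pi> j)))))"
proof -
  have bij: "bij_betw f (points m M) (points n N)"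
    and dist: "\<And>x y. x \<in> points m M \<Longrightarrow> y \<in> points m M \<Longrightarrow>
      sup_dist n N (f x) (f y) = sup_dist m M x y"
    using assms(1,2,11) unfolding metric_isometry_def by auto
  have "sup_isometry m n M N f (inv_into (points m M) f)"
  proof
    show "factor_space (M i)" if "i \<in> {1..m}" for i
      unfolding factor_space_def
      by (intro conjI ballI assms(3-6)[OF that] path_connected_imp_connected_space
          locally_uniquely_geodesic_normal_radius)
    show "factor_space (N j)" if "j \<in> {1..n}" for j
      unfolding factor_space_def
      by (intro conjI ballI assms(7-10)[OF that] path_connected_imp_connected_space
          locally_uniquely_geodesic_normal_radius)
    show "f x \<in> points n N" if "x \<in> points m M" for x
      using bij_betwE[OF bij] that by blast
    show "inv_into (points m M) f y \<in> points m M" if "y \<in> points n N" for y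
      using bij_betwE[OF bij_betw_inv_into[OF bij]] that by blast
    show "inv_into (points m M) f (f x) = x" if "x \<in> points m M" for x
      using bij_betw_inv_into_left[OF bij that] .
    show "f (inv_into (points m M) f y) = y" if "y \<in> points n N" for y
      using bij_betw_inv_into_right[OF bij that] .
  qed (use assms(1,2) dist in auto)
  then show ?thesis by (rule sup_isometry.reducible)
qed

end
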